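(* Let $P=\{p(y|x),\ x\in\mathcal{X},\ y\in\mathcal{Y}\}$ be an arbitrary discrete memoryless channel with finite input alphabet $\mathcal{X}$ and finite output alphabet $\mathcal{Y}$, let $Q=\{q(x),\ x\in\mathcal{X}\}$ be a probability mass function on $\mathcal{X}$, and let $R\ge 0$. For $\rho\ge 1$ and $0\le s\le 1$ define $$E(\rho,s,Q)=-\rho\sum_{x\in\mathcal{X}}q(x)\ln\left(\sum_{x'\in\mathcal{X}}q(x')\left[\sum_{y\in\mathcal{Y}}p^{1-s}(y|x)\,p^{s}(y|x')\right]^{1/\rho}\right)$$ and $$\mathcal{E}(R,Q)=\sup_{\rho\ge 1}\ \sup_{0\le s\le 1}\left[E(\rho,s,Q)-\rho R\right].$$ Then there exists a sequence of codes $\{\mathcal{C}_n\}_{n\ge 1}$ of rate $R$ and composition $Q$ for which the error exponent associated with the maximum error probability is at least as large as $\mathcal{E}(R,Q)$, i.e. $$\liminf_{n\to\infty}\left[-\frac{1}{n}\ln \max_{1\le m\le M}P_{e|m}(\mathcal{C}_n)\right]\ \ge\ \mathcal{E}(R,Q).$$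
   Context: The channel acts on blocks of length $n$ memorylessly: for $\boldsymbol{x}=(x_1,\ldots,x_n)\in\mathcal{X}^n$ and $\boldsymbol{y}=(y_1,\ldots,y_n)\in\mathcal{Y}^n$, $p(\boldsymbol{y}|\boldsymbol{x})=\prod_{i=1}^n p(y_i|x_i)$. A code $\mathcal{C}_n=\{\boldsymbol{x}_1,\ldots,\boldsymbol{x}_M\}$ of block length $n$ and rate $R$ consists of $M=e^{nR}$ (rounded to an integer) codewords $\boldsymbol{x}_m\in\mathcal{X}^n$, where $\boldsymbol{x}_m$ is transmitted for message $m\in\{1,\ldots,M\}$. The receiver observes $\boldsymbol{y}$ and uses maximum likelihood decoding, i.e. it outputs a message $m$ maximizing $p(\boldsymbol{y}|\boldsymbol{x}_m)$. $P_{e|m}=P_{e|m}(\mathcal{C}_n)$ is the conditional probability of a decoding error given that message $m$ was sent, and the maximum error probability of the code is $\max_m P_{e|m}$. A sequence of codes with composition $Q$ means a sequence of fixed composition codes (for each $n$, all codewords of $\mathcal{C}_n$ have the same empirical distribution on $\mathcal{X}$) such that the common empirical distribution of all codewords of $\mathcal{C}_n$ tends to $Q$ as $n\to\infty$. Conventions: $\ln$ is the natural logarithm and $-\ln 0=+\infty$. The value $+\infty$ is allowed for $\mathcal{E}(R,Q)$ and for error exponents. *)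

theory Defs
  imports "HOL-Probability.Probability"
begin

definition neg_ln :: "real \<Rightarrow> ereal" where
  "neg_ln t = (if t = 0 then \<infinity> else ereal (- ln t))"

text \<open>
  A discrete memoryless channel is a stochastic kernel \<open>W\<close> between finite types, with
  \<open>p(y|x) = pmf (W x) y\<close>.  Blocks of length \<open>n\<close> are lists of length \<open>n\<close>.
\<close>

definition blocks :: "nat \<Rightarrow> 'a list set" where
  "blocks n = {v. length v = n}"

definition block_prob :: "('x \<Rightarrow> 'y pmf) \<Rightarrow> nat \<Rightarrow> 'x list \<Rightarrow> 'y list \<Rightarrow> real" where
  "block_prob W n u v = (\<Prod>i<n. pmf (W (u ! i)) (v ! i))"

text \<open>
  A code with \<open>M\<close> messages is a map \<open>c\<close> of which only the values on \<open>{1..M}\<close> matter; as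
  codewords are indexed by messages, repetitions are allowed.  (For \<open>R\<close> larger than the entropy
  of \<open>Q\<close> there are fewer than \<open>exp (n R)\<close> words of composition close to \<open>Q\<close>.)
  Of the possible roundings of \<open>exp (n R)\<close>, rounding up makes the largest code.
\<close>

definition codebook_size :: "real \<Rightarrow> nat \<Rightarrow> nat" where
  "codebook_size R n = nat \<lceil>exp (real n * R)\<rceil>"

definition is_code :: "nat \<Rightarrow> nat \<Rightarrow> (nat \<Rightarrow> 'x list) \<Rightarrow> bool" where
  "is_code n M c \<longleftrightarrow> (\<forall>m\<in>{1..M}. c m \<in> blocks n)"

definition empirical :: "'x list \<Rightarrow> 'x \<Rightarrow> real" where
  "empirical u a = real (count_list u a) / real (length u)"

definition code_seq :: "real \<Rightarrow> 'x pmf \<Rightarrow> (nat \<Rightarrow> nat \<Rightarrow> 'x list) \<Rightarrow> bool" where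
  "code_seq R Q C \<longleftrightarrow>
     (\<forall>n\<ge>1. is_code n (codebook_size R n) (C n)) \<and>
     (\<exists>T. (\<forall>n\<ge>1. \<forall>m\<in>{1..codebook_size R n}. empirical (C n m) = T n) \<and>
          (\<forall>a. (\<lambda>n. T n a) \<longlonglongrightarrow> pmf Q a))"

text \<open>Ties may be broken in any way.\<close>

definition max_likelihood_decoder ::
  "('x \<Rightarrow> 'y pmf) \<Rightarrow> nat \<Rightarrow> nat \<Rightarrow> (nat \<Rightarrow> 'x list) \<Rightarrow> ('y list \<Rightarrow> nat) \<Rightarrow> bool" where
  "max_likelihood_decoder W n M c d \<longleftrightarrow>
     (\<forall>v\<in>blocks n. d v \<in> {1..M} \<and>
        (\<forall>m\<in>{1..M}. block_prob W n (c m) v \<le> block_prob W n (c (d v)) v))"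

definition error_prob ::
  "('x \<Rightarrow> 'y pmf) \<Rightarrow> nat \<Rightarrow> (nat \<Rightarrow> 'x list) \<Rightarrow> ('y list \<Rightarrow> nat) \<Rightarrow> nat \<Rightarrow> real" where
  "error_prob W n c d m = (\<Sum>v\<in>{v \<in> blocks n. d v \<noteq> m}. block_prob W n (c m) v)"

definition max_error_prob ::
  "('x \<Rightarrow> 'y pmf) \<Rightarrow> nat \<Rightarrow> nat \<Rightarrow> (nat \<Rightarrow> 'x list) \<Rightarrow> ('y list \<Rightarrow> nat) \<Rightarrow> real" where
  "max_error_prob W n M c d = Max (error_prob W n c d ` {1..M})"

text \<open>
  Real-valued \<open>ln\<close> suffices in \<open>E_fun\<close>: by \<open>E_fun_arg_ge\<close> its argument is positive whenever its
  weight \<open>q(x)\<close> is.  At the endpoints of \<open>0 \<le> s \<le> 1\<close>, \<open>powr\<close> has \<open>0 powr 0 = 0\<close>, which makes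
  \<open>E_fun\<close> continuous in \<open>s\<close>; with \<open>0\<^sup>0 = 1\<close> it would vanish at the endpoints, and as it is
  nonnegative on \<open>0 < s < 1\<close> the supremum in \<open>E_exponent\<close> would be the same.
\<close>

definition E_fun ::
  "('x::finite \<Rightarrow> 'y::finite pmf) \<Rightarrow> real \<Rightarrow> real \<Rightarrow> 'x pmf \<Rightarrow> real" where
  "E_fun W \<rho> s Q =
     - \<rho> * (\<Sum>x\<in>UNIV. pmf Q x *
         ln (\<Sum>x'\<in>UNIV. pmf Q x' *
               (\<Sum>y\<in>UNIV. pmf (W x) y powr (1 - s) * pmf (W x') y powr s) powr (1 / \<rho>)))"

lemma E_fun_arg_ge:
  fixes W :: "'x::finite \<Rightarrow> 'y::finite pmf" and Q :: "'x pmf"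
  shows "pmf Q x \<le> (\<Sum>x'\<in>UNIV. pmf Q x' *
           (\<Sum>y\<in>UNIV. pmf (W x) y powr (1 - s) * pmf (W x') y powr s) powr (1 / \<rho>))"
proof -
  let ?d = "\<lambda>x'. (\<Sum>y\<in>UNIV. pmf (W x) y powr (1 - s) * pmf (W x') y powr s) powr (1 / \<rho>)"
  have "(\<Sum>y\<in>UNIV. pmf (W x) y powr (1 - s) * pmf (W x) y powr s) = (\<Sum>y\<in>UNIV. pmf (W x) y)"
    by (simp flip: powr_add)
  also have "\<dots> = 1"
    by (rule sum_pmf_eq_1) auto
  finally have "pmf Q x = pmf Q x * ?d x"
    by simp
  also have "\<dots> \<le> (\<Sum>x'\<in>UNIV. pmf Q x' * ?d x')"
    by (rule member_le_sum) auto
  finally show ?thesis .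
qed

definition E_exponent ::
  "('x::finite \<Rightarrow> 'y::finite pmf) \<Rightarrow> real \<Rightarrow> 'x pmf \<Rightarrow> ereal" where
  "E_exponent W R Q = (SUP \<rho>\<in>{1..}. SUP s\<in>{0..1}. ereal (E_fun W \<rho> s Q - \<rho> * R))"

end

theory Submission
  imports Defs "HOL-Combinatorics.Multiset_Permutations" "HOL-Real_Asymp.Real_Asymp"
begin

text \<open>
  For \<open>s \<in> [0, 1]\<close> the probability that a message \<open>m\<close> is confused with \<open>m'\<close> is at most
  \<open>D(m, m') = (\<Prod>i. \<Sum>y. p(y|x\<^sub>i)\<^bsup>1-s\<^esup> p(y|x'\<^sub>i)\<^bsup>s\<^esup>)\<close>, and for \<open>\<rho> \<ge> 1\<close> the union bound
  \<open>\<Sum>m'. D(m, m')\<close> is at most the \<open>\<rho>\<close>-th power of \<open>\<Sum>m'. D(m, m')\<^bsup>1/\<rho>\<^esup>\<close>.  The average of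
  \<open>D\<^bsup>1/\<rho>\<^esup>\<close> over \<open>x'\<close> in the type class of \<open>T\<close>, for fixed \<open>x\<close> in it, exceeds the average over
  \<open>x'\<close> with independent letters distributed as \<open>T\<close> by at most a polynomial factor, because the
  type class is not too unlikely under its own type; the latter average is
  \<open>exp (- n E(\<rho>, s, T) / \<rho>)\<close>.  Expurgating the worse half of a code with \<open>2 M\<close> words and small
  total \<open>D\<^bsup>1/\<rho>\<^esup>\<close> yields the bound for every message, and letting \<open>T\<close> tend to \<open>Q\<close> with support
  inside that of \<open>Q\<close> gives the exponent.
\<close>

section \<open>Expurgation\<close>

lemma exists_le_average:
  fixes f :: "'a \<Rightarrow> real"
  assumes "finite T" "T \<noteq> {}" "sum f T \<le> real (card T) * b"
  shows "\<exists>x\<in>T. f x \<le> b"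
proof (rule ccontr)
  assume "\<not> ?thesis"
  then have "(\<Sum>x\<in>T. b) < sum f T"
    using assms by (intro sum_strict_mono) auto
  then show False using assms by simp
qed

text \<open>
  Method of conditional expectations.  A row bound does not control the columns of \<open>f\<close>, so the
  column averages of the words already chosen are carried along as a potential.
\<close>

lemma exists_small_pair_sum_potential:
  fixes f :: "'a \<Rightarrow> 'a \<Rightarrow> real"
  assumes T: "finite T" "T \<noteq> {}"
    and row: "\<And>x. x \<in> T \<Longrightarrow> (\<Sum>y\<in>T. f x y) \<le> real (card T) * B"
    and "K \<ge> 0"
  shows "\<exists>c. (\<forall>i<N. c i \<in> T) \<and>
    (\<Sum>i<N. \<Sum>j\<in>{..<N} - {i}. f (c i) (c j)) + K * (\<Sum>i<N. (\<Sum>x\<in>T. f x (c i)) / real (card T))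
      \<le> real N * (real N - 1) * B + K * real N * B"
  using \<open>K \<ge> 0\<close>
proof (induction N arbitrary: K)
  case 0
  then show ?case by simp
next
  case (Suc N)
  define col where "col y = (\<Sum>x\<in>T. f x y) / real (card T)" for y
  have cT: "real (card T) > 0" using T by (simp add: card_gt_0_iff)
  \<comment> \<open>A new word \<open>x\<close> is also charged \<open>f x (c i)\<close> for every
    old \<open>i\<close>, which averages to \<open>col (c i)\<close> over \<open>T\<close>. Raising
    the weight from \<open>K\<close> to \<open>K + 1\<close> pays for exactly this.\<close>
  obtain c where cT': "\<And>i. i < N \<Longrightarrow> c i \<in> T" and
    c: "(\<Sum>i<N. \<Sum>j\<in>{..<N} - {i}. f (c i) (c j)) + (K + 1) * (\<Sum>i<N. col (c i))
      \<le> real N * (real N - 1) * B + (K + 1) * real N * B"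
    using Suc.IH[of "K + 1"] Suc.prems by (auto simp: col_def)
  let ?inc = "\<lambda>x. (\<Sum>i<N. f (c i) x) + (\<Sum>i<N. f x (c i)) + K * col x"
  have colT: "real (card T) * col y = (\<Sum>x\<in>T. f x y)" for y
    using cT by (simp add: col_def)
  have "(\<Sum>x\<in>T. \<Sum>i<N. f (c i) x) \<le> (\<Sum>i<N. real (card T) * B)"
    by (subst sum.swap, rule sum_mono) (use row cT' in auto)
  moreover have "(\<Sum>x\<in>T. \<Sum>i<N. f x (c i)) = real (card T) * (\<Sum>i<N. col (c i))"
    by (subst sum.swap) (simp add: sum_distrib_left colT)
  moreover have "(\<Sum>x\<in>T. K * col x) \<le> K * (real (card T) * B)"
  proof -
    have "real (card T) * (\<Sum>x\<in>T. col x) = (\<Sum>x\<in>T. \<Sum>y\<in>T. f x y)"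
      by (subst sum.swap) (simp add: sum_distrib_left colT)
    also have "\<dots> \<le> (\<Sum>x\<in>T. real (card T) * B)"
      by (intro sum_mono row)
    finally have "(\<Sum>x\<in>T. col x) \<le> real (card T) * B"
      using cT by (simp add: mult_le_cancel_left_pos)
    then show ?thesis
      using Suc.prems by (simp add: sum_distrib_left[symmetric] mult_left_mono)
  qed
  ultimately have "sum ?inc T \<le> real (card T) * (real N * B + (\<Sum>i<N. col (c i)) + K * B)"
    by (simp add: sum.distrib algebra_simps)
  then obtain x where x: "x \<in> T" "?inc x \<le> real N * B + (\<Sum>i<N. col (c i)) + K * B"
    using exists_le_average[OF T] by blast
  define c' where "c' = c(N := x)"
  have c'N: "c' N = x" and c'i: "\<And>i. i < N \<Longrightarrow> c' i = c i"
    by (auto simp: c'_def)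
  have "(\<Sum>j\<in>{..<Suc N} - {i}. f (c' i) (c' j))
      = (\<Sum>j\<in>{..<N} - {i}. f (c i) (c j)) + f (c i) x" if "i < N" for i
  proof -
    have "{..<Suc N} - {i} = insert N ({..<N} - {i})" using that by auto
    then show ?thesis using that by (simp add: c'N c'i)
  qed
  moreover have "{..<Suc N} - {N} = {..<N}" by auto
  ultimately have "(\<Sum>i<Suc N. \<Sum>j\<in>{..<Suc N} - {i}. f (c' i) (c' j))
      = (\<Sum>i<N. \<Sum>j\<in>{..<N} - {i}. f (c i) (c j)) + (\<Sum>i<N. f (c i) x) + (\<Sum>i<N. f x (c i))"
    by (simp add: sum.distrib c'N c'i)
  moreover have "(\<Sum>i<Suc N. col (c' i)) = (\<Sum>i<N. col (c i)) + col x"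
    by (simp add: c'N c'i)
  ultimately have "(\<Sum>i<Suc N. \<Sum>j\<in>{..<Suc N} - {i}. f (c' i) (c' j)) + K * (\<Sum>i<Suc N. col (c' i))
      \<le> real (Suc N) * (real (Suc N) - 1) * B + K * real (Suc N) * B"
    using x(2) c by (simp only: of_nat_Suc) (simp add: algebra_simps)
  moreover have "\<forall>i<Suc N. c' i \<in> T"
    using x(1) cT' by (auto simp: c'_def less_Suc_eq)
  ultimately show ?case by (auto simp: col_def)
qed

text \<open>Among \<open>2 * M\<close> words of small pair sum the mean row sum is at most
  \<open>2 * M * B\<close>, so by Markov at most \<open>M\<close> words exceed twice that. Keeping
  \<open>M\<close> of the others only removes nonnegative terms from their row sums.\<close>

lemma exists_small_row_sums:
  fixes f :: "'a \<Rightarrow> 'a \<Rightarrow> real"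
  assumes T: "finite T" "T \<noteq> {}" and f: "\<And>x y. f x y \<ge> 0" and "B \<ge> 0"
    and row: "\<And>x. x \<in> T \<Longrightarrow> (\<Sum>y\<in>T. f x y) \<le> real (card T) * B"
  shows "\<exists>c\<in>{1..M} \<rightarrow>\<^sub>E T. \<forall>m\<in>{1..M}. (\<Sum>j\<in>{1..M} - {m}. f (c m) (c j)) \<le> 4 * real M * B"
proof -
  \<comment> \<open>\<open>order_refl\<close> instantiates the weight \<open>K\<close> to 0, so that
    only the pair sum is left.\<close>
  obtain c where cT: "\<And>i. i < 2 * M \<Longrightarrow> c i \<in> T" and
    c: "(\<Sum>i<2 * M. \<Sum>j\<in>{..<2 * M} - {i}. f (c i) (c j)) \<le> real (2 * M) * (real (2 * M) - 1) * B"
    using exists_small_pair_sum_potential[OF T row order_refl, of "\<lambda>x. x" "2 * M"] by auto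
  define S where "S i = (\<Sum>j\<in>{..<2 * M} - {i}. f (c i) (c j))" for i
  define bad where "bad = {i. i < 2 * M \<and> S i > 4 * real M * B}"
  define good where "good = {i. i < 2 * M \<and> S i \<le> 4 * real M * B}"
  have S0: "S i \<ge> 0" for i unfolding S_def by (intro sum_nonneg f)
  have "card bad \<le> M"
  proof (rule ccontr)
    assume *: "\<not> card bad \<le> M"
    then have "bad \<noteq> {}" by auto
    moreover have "finite bad" by (simp add: bad_def)
    ultimately have "(\<Sum>i\<in>bad. 4 * real M * B) < sum S bad"
      by (intro sum_strict_mono) (auto simp: bad_def)
    also have "\<dots> \<le> sum S {..<2 * M}"
      by (intro sum_mono2) (auto simp: bad_def S0)
    also have "\<dots> \<le> real (2 * M) * (real (2 * M) - 1) * B"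
      using c by (simp add: S_def)
    finally have "real (card bad) * (4 * real M * B) < real M * (4 * real M * B) - 2 * real M * B"
      by (simp add: algebra_simps)
    moreover have "real M * (4 * real M * B) \<le> real (card bad) * (4 * real M * B)"
      using * \<open>B \<ge> 0\<close> by (intro mult_right_mono) auto
    moreover have "0 \<le> 2 * real M * B" using \<open>B \<ge> 0\<close> by simp
    ultimately show False by linarith
  qed
  moreover have "card bad + card good = 2 * M"
  proof -
    have "bad \<union> good = {..<2 * M}" "bad \<inter> good = {}"
      by (auto simp: bad_def good_def)
    then show ?thesis
      using card_Un_disjoint[of bad good] by (simp add: bad_def good_def)
  qed
  ultimately have "M \<le> card good" by linarith
  then obtain G where G: "G \<subseteq> good" "card G = M" "finite G"
    by (rule obtain_subset_with_card_n)
  obtain h where h: "bij_betw h {1..M} G"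
    using ex_bij_betw_nat_finite_1[OF G(3)] G(2) by auto
  have hG: "h i \<in> good" if "i \<in> {1..M}" for i
    using bij_betwE[OF h] G(1) that by blast
  \<comment> \<open>Restriction puts the code into the extensional function space, which is finite
    and in which a best code can be chosen later.\<close>
  define c' where "c' = restrict (c \<circ> h) {1..M}"
  have "(\<Sum>j\<in>{1..M} - {m}. f (c' m) (c' j)) \<le> 4 * real M * B" if m: "m \<in> {1..M}" for m
  proof -
    have inj1: "inj_on h {1..M}" using h by (rule bij_betw_imp_inj_on)
    then have inj: "inj_on h ({1..M} - {m})" by (rule inj_on_subset) blast
    have sub: "h ` ({1..M} - {m}) \<subseteq> {..<2 * M} - {h m}"
    proof (rule image_subsetI)
      fix j assume j: "j \<in> {1..M} - {m}"
      then have "h j \<noteq> h m" using inj_onD[OF inj1, of j m] m by blast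
      then show "h j \<in> {..<2 * M} - {h m}" using hG[of j] j by (simp add: good_def)
    qed
    have "(\<Sum>j\<in>{1..M} - {m}. f (c' m) (c' j)) = (\<Sum>j\<in>h ` ({1..M} - {m}). f (c (h m)) (c j))"
      using m by (subst sum.reindex[OF inj]) (auto simp: c'_def intro!: sum.cong)
    also have "\<dots> \<le> S (h m)"
      unfolding S_def using sub by (intro sum_mono2) (auto intro: f)
    also have "\<dots> \<le> 4 * real M * B"
      using hG[OF m] by (simp add: good_def)
    finally show ?thesis .
  qed
  moreover have "c' \<in> {1..M} \<rightarrow>\<^sub>E T"
    using hG cT by (auto simp: c'_def good_def)
  ultimately show ?thesis by blast
qed

section \<open>Averages over a type class\<close>

lemma finite_blocks [simp]: "finite (blocks n :: 'a::finite list set)"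
  using finite_lists_length_eq[of "UNIV :: 'a set" n] by (simp add: blocks_def)

text \<open>Distributivity: expanding the product of sums picks one letter per position. It
  factorizes both sums over output blocks and averages over independent letters.\<close>

lemma sum_blocks_prod:
  fixes h :: "nat \<Rightarrow> 'a::finite \<Rightarrow> 'b::comm_semiring_1"
  shows "(\<Sum>v\<in>blocks n. \<Prod>i<n. h i (v ! i)) = (\<Prod>i<n. \<Sum>a\<in>UNIV. h i a)"
proof (induction n arbitrary: h)
  case 0
  then show ?case by (simp add: blocks_def)
next
  case (Suc n)
  have eq: "blocks (Suc n) = (\<lambda>(a :: 'a, v). a # v) ` (UNIV \<times> blocks n)"
    by (auto simp: blocks_def length_Suc_conv)
  have "(\<Sum>v\<in>blocks (Suc n). \<Prod>i<Suc n. h i (v ! i))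
      = (\<Sum>(a, v)\<in>UNIV \<times> blocks n. h 0 a * (\<Prod>i<n. h (Suc i) (v ! i)))"
    unfolding eq
    by (subst sum.reindex) (auto simp: inj_on_def prod.lessThan_Suc_shift case_prod_beta simp del: prod.lessThan_Suc)
  also have "\<dots> = (\<Sum>a\<in>UNIV. h 0 a) * (\<Sum>v\<in>blocks n. \<Prod>i<n. h (Suc i) (v ! i))"
    by (simp add: sum_product sum.cartesian_product)
  also have "\<dots> = (\<Prod>i<Suc n. \<Sum>a\<in>UNIV. h i a)"
    by (simp add: Suc.IH[of "\<lambda>i. h (Suc i)"] prod.lessThan_Suc_shift del: prod.lessThan_Suc)
  finally show ?case .
qed

section \<open>Stirling-type bounds on the factorial\<close>

lemma power_self_le_exp_fact: "real n ^ n \<le> exp (real n) * fact n"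
proof -
  \<comment> \<open>The left side is a single term of the exponential series.\<close>
  have "real n ^ n / fact n \<le> (\<Sum>k. real n ^ k / fact k)"
    using sum_le_suminf[OF summable_exp_generic[of "real n"], of "{n}"]
    by (simp add: field_simps)
  also have "\<dots> = exp (real n)" by (simp add: exp_def field_simps)
  finally show ?thesis by (simp add: field_simps)
qed

text \<open>A crude upper half of Stirling's formula. The factor \<open>k + 1\<close> covers
  \<open>k = 0\<close>, where \<open>0 ^ 0 = 1\<close>; for positive \<open>k\<close> the induction
  yields the factor \<open>k\<close>.\<close>

lemma fact_exp_le: "fact k * exp (real k) \<le> exp 1 * (real k + 1) * real k ^ k"
proof -
  have bound: "fact (Suc k) * exp (real (Suc k)) \<le> exp 1 * real (Suc k) * real (Suc k) ^ Suc k" for k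
  proof (induction k)
    case 0
    then show ?case by simp
  next
    case (Suc k)
    let ?a = "real (Suc k)" and ?b = "real (Suc (Suc k))"
    \<comment> \<open>\<open>ln t \<le> t - 1\<close> at \<open>t = ?a / ?b\<close> leads to
      \<open>(1 + 1 / ?a) ^ Suc (Suc k) \<ge> exp 1\<close>, the growth that the induction step
      needs.\<close>
    have "1 / ?b \<le> ln (?b / ?a)"
      using ln_le_minus_one[of "?a / ?b"] by (simp add: ln_div field_simps)
    then have "?b * (1 / ?b) \<le> ?b * ln (?b / ?a)"
      by (intro mult_left_mono) auto
    then have "exp 1 \<le> exp (?b * ln (?b / ?a))" by simp
    also have "\<dots> = (?b / ?a) ^ Suc (Suc k)"
      by (subst exp_of_nat_mult) simp
    finally have e: "exp 1 * ?a ^ Suc (Suc k) \<le> ?b ^ Suc (Suc k)"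
      by (simp only: power_divide pos_le_divide_eq zero_less_power of_nat_0_less_iff zero_less_Suc)
    have "fact (Suc (Suc k)) * exp ?b = ?b * exp 1 * (fact (Suc k) * exp ?a)"
      by (simp add: mult_exp_exp mult_ac)
    also have "\<dots> \<le> ?b * exp 1 * (exp 1 * ?a * ?a ^ Suc k)"
      by (intro mult_left_mono Suc.IH) auto
    also have "\<dots> = ?b * exp 1 * (exp 1 * ?a ^ Suc (Suc k))"
      by simp
    also have "\<dots> \<le> ?b * exp 1 * ?b ^ Suc (Suc k)"
      by (intro mult_left_mono e) auto
    finally show ?case by (simp add: mult_ac)
  qed
  show ?thesis
  proof (cases k)
    case (Suc j)
    have "exp 1 * real (Suc j) * real (Suc j) ^ Suc j \<le> exp 1 * (real (Suc j) + 1) * real (Suc j) ^ Suc j"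
      by (intro mult_right_mono mult_left_mono) auto
    moreover have "fact (Suc j) * exp (real (Suc j)) \<le> exp 1 * real (Suc j) * real (Suc j) ^ Suc j"
      by (rule bound)
    ultimately show ?thesis unfolding Suc by linarith
  qed simp
qed

section \<open>Type classes under the product measure of their own type\<close>

lemma size_multiset_eq_sum_UNIV: "size A = (\<Sum>a\<in>UNIV. count A (a :: 'a::finite))"
  unfolding size_multiset_overloaded_eq by (intro sum.mono_neutral_left) (auto simp: not_in_iff)

lemma prod_nth_eq_prod_count:
  fixes h :: "'a::finite \<Rightarrow> 'b::comm_semiring_1"
  assumes "mset u = A"
  shows "(\<Prod>i<size A. h (u ! i)) = (\<Prod>a\<in>UNIV. h a ^ count A a)"
proof -
  have "(\<Prod>i<length u. h (u ! i)) = (\<Prod>a\<in>UNIV. h a ^ count (mset u) a)"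
  proof (induction u)
    case (Cons b u)
    have "(\<Prod>a\<in>UNIV. h a ^ count (mset (b # u)) a)
        = (\<Prod>a\<in>UNIV. (if a = b then h a else 1) * h a ^ count (mset u) a)"
      by (intro prod.cong) auto
    also have "\<dots> = h b * (\<Prod>a\<in>UNIV. h a ^ count (mset u) a)"
      by (simp add: prod.distrib)
    finally show ?case
      using Cons.IH by (simp add: prod.lessThan_Suc_shift del: prod.lessThan_Suc)
  qed simp
  then show ?thesis using assms by auto
qed

text \<open>Under independent letters of law \<open>count A a / n\<close> every word of the class
  has the same probability, the last product. The size of the class is a multinomial coefficient,
  and the two Stirling bounds keep the total probability above an inverse polynomial in
  \<open>n\<close>.\<close>

lemma type_class_mass:
  fixes A :: "'a::finite multiset"
  defines "n \<equiv> size A"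
  shows "1 \<le> (exp 1 * (real n + 1)) ^ CARD('a) * real (card (permutations_of_multiset A)) *
    (\<Prod>a\<in>UNIV. (real (count A a) / real n) ^ count A a)"
proof -
  let ?C = "(exp 1 * (real n + 1)) ^ CARD('a)"
  let ?c = "real (card (permutations_of_multiset A))"
  let ?F = "\<Prod>a\<in>UNIV. fact (count A a) :: real"
  let ?k = "\<Prod>a\<in>UNIV. real (count A a) ^ count A a"
  have n: "n = (\<Sum>a\<in>UNIV. count A a)"
    unfolding n_def by (rule size_multiset_eq_sum_UNIV)
  have "card (permutations_of_multiset A) * (\<Prod>a\<in>UNIV. fact (count A a)) = fact n"
  proof -
    have "(\<Prod>a\<in>UNIV. fact (count A a)) = (\<Prod>a\<in>set_mset A. fact (count A a) :: nat)"
      by (intro prod.mono_neutral_right) (auto simp: not_in_iff)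
    then show ?thesis using card_permutations_of_multiset_aux[of A] by (simp add: n_def)
  qed
  then have "real (card (permutations_of_multiset A) * (\<Prod>a\<in>UNIV. fact (count A a))) = real (fact n)"
    by (simp only:)
  then have card: "?c * ?F = fact n" by simp
  have "?F * exp (real n) = (\<Prod>a\<in>UNIV. fact (count A a) * exp (real (count A a)))"
    by (simp add: prod.distrib n exp_sum)
  also have "\<dots> \<le> (\<Prod>a\<in>UNIV. exp 1 * (real n + 1) * real (count A a) ^ count A a)"
  proof (intro prod_mono conjI)
    fix a
    have "count A a \<le> n" by (simp add: n_def count_le_size)
    then have "exp 1 * (real (count A a) + 1) * real (count A a) ^ count A a
        \<le> exp 1 * (real n + 1) * real (count A a) ^ count A a"
      by (intro mult_right_mono mult_left_mono) auto
    then show "fact (count A a) * exp (real (count A a))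
        \<le> exp 1 * (real n + 1) * real (count A a) ^ count A a"
      using fact_exp_le[of "count A a"] by linarith
  qed simp
  also have "\<dots> = ?C * ?k" by (simp add: prod.distrib)
  finally have F: "?F * exp (real n) \<le> ?C * ?k" .
  have "real n ^ n \<le> exp (real n) * (?c * ?F)"
    unfolding card by (rule power_self_le_exp_fact)
  also have "\<dots> = ?c * (?F * exp (real n))" by simp
  also have "\<dots> \<le> ?c * (?C * ?k)" by (intro mult_left_mono F) auto
  finally have *: "real n ^ n \<le> ?C * ?c * ?k" by (simp add: mult_ac)
  \<comment> \<open>For empty \<open>A\<close> this is \<open>0 ^ 0 = 1\<close>.\<close>
  have pos: "real n ^ n > 0" by (cases "n = 0") auto
  have "(\<Prod>a\<in>UNIV. (real (count A a) / real n) ^ count A a) = ?k / real n ^ n"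
    by (simp add: power_divide prod_dividef power_sum[symmetric] n)
  moreover have "1 \<le> ?C * ?c * ?k / real n ^ n"
    using * pos by (simp only: pos_le_divide_eq mult_1_left)
  ultimately show ?thesis by (simp only: times_divide_eq_right)
qed

text \<open>Change of measure: weighting the words by their product probability is multiplication by
  the constant \<open>?P\<close>. The sum can then be enlarged to all blocks, where it factorizes,
  and \<open>type_class_mass\<close> removes \<open>?P\<close> at polynomial cost.\<close>

lemma sum_type_class_prod_le:
  fixes A :: "'a::finite multiset" and g :: "nat \<Rightarrow> 'a \<Rightarrow> real"
  defines "n \<equiv> size A"
  assumes g: "\<And>i a. g i a \<ge> 0"
  shows "(\<Sum>v\<in>permutations_of_multiset A. \<Prod>i<n. g i (v ! i))
    \<le> (exp 1 * (real n + 1)) ^ CARD('a) * real (card (permutations_of_multiset A)) *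
       (\<Prod>i<n. \<Sum>a\<in>UNIV. real (count A a) / real n * g i a)"
proof -
  let ?q = "\<lambda>a. real (count A a) / real n"
  let ?C = "(exp 1 * (real n + 1)) ^ CARD('a) * real (card (permutations_of_multiset A))"
  let ?S = "\<Sum>v\<in>permutations_of_multiset A. \<Prod>i<n. g i (v ! i)"
  let ?P = "\<Prod>a\<in>UNIV. ?q a ^ count A a"
  have "?P * ?S = (\<Sum>v\<in>permutations_of_multiset A. \<Prod>i<n. ?q (v ! i) * g i (v ! i))"
    unfolding sum_distrib_left n_def
    by (intro sum.cong refl)
      (simp only: prod.distrib prod_nth_eq_prod_count[OF permutations_of_multisetD, where h = "\<lambda>a. real (count A a) / real (size A)"])
  also have "\<dots> \<le> (\<Sum>v\<in>blocks n. \<Prod>i<n. ?q (v ! i) * g i (v ! i))"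
  proof (intro sum_mono2 prod_nonneg)
    show "permutations_of_multiset A \<subseteq> blocks n"
      by (auto simp: blocks_def n_def length_finite_permutations_of_multiset)
  qed (auto simp: g)
  also have "\<dots> = (\<Prod>i<n. \<Sum>a\<in>UNIV. ?q a * g i a)"
    by (rule sum_blocks_prod)
  finally have PS: "?P * ?S \<le> (\<Prod>i<n. \<Sum>a\<in>UNIV. ?q a * g i a)" .
  have "1 * ?S \<le> ?C * ?P * ?S"
    using type_class_mass[of A]
    by (intro mult_right_mono sum_nonneg prod_nonneg) (auto simp: g n_def)
  also have "\<dots> = ?C * (?P * ?S)" by simp
  also have "\<dots> \<le> ?C * (\<Prod>i<n. \<Sum>a\<in>UNIV. ?q a * g i a)"
    by (intro mult_left_mono PS) auto
  finally show ?thesis by simp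
qed

text \<open>The factor at position \<open>i\<close> depends only on the letter \<open>u ! i\<close>,
  which takes the value \<open>a\<close> exactly \<open>n * q a\<close> times; grouping by letters
  gives the exponential.\<close>

lemma type_class_row_sum:
  fixes A :: "'a::finite multiset" and g :: "'a \<Rightarrow> 'a \<Rightarrow> real"
  defines "n \<equiv> size A" and "q \<equiv> (\<lambda>a. real (count A a) / real (size A))"
  assumes g: "\<And>a b. g a b \<ge> 0" "\<And>a. g a a = 1" and u: "u \<in> permutations_of_multiset A"
  shows "(\<Sum>v\<in>permutations_of_multiset A. \<Prod>i<n. g (u ! i) (v ! i))
    \<le> real (card (permutations_of_multiset A)) * ((exp 1 * (real n + 1)) ^ CARD('a) *
       exp (real n * (\<Sum>a\<in>UNIV. q a * ln (\<Sum>b\<in>UNIV. q b * g a b))))"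
proof -
  define \<phi> where "\<phi> a = (\<Sum>b\<in>UNIV. q b * g a b)" for a
  have "\<phi> a ^ count A a = exp (real n * (q a * ln (\<phi> a)))" for a
  \<comment> \<open>An absent letter contributes 1 on both sides, whatever \<open>ln\<close>
    returns. For a present letter \<open>g a a = 1\<close> makes \<open>\<phi> a\<close>
    positive.\<close>
  proof (cases "count A a = 0")
    case False
    then have n0: "n > 0" unfolding n_def by (metis count_le_size le_0_eq neq0_conv)
    have "q a > 0" using False n0 by (simp add: q_def n_def)
    moreover have "q a * g a a \<le> \<phi> a"
      unfolding \<phi>_def by (intro member_le_sum) (auto simp: q_def g)
    ultimately have "\<phi> a > 0" by (simp add: g)
    moreover have "real n * q a = real (count A a)" using n0 by (simp add: q_def n_def)
    then have "real n * (q a * ln (\<phi> a)) = real (count A a) * ln (\<phi> a)"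
      by (simp only: mult.assoc[symmetric])
    ultimately show ?thesis by (simp only: exp_of_nat_mult exp_ln)
  qed (simp add: q_def)
  then have "(\<Prod>i<n. \<phi> (u ! i)) = exp (real n * (\<Sum>a\<in>UNIV. q a * ln (\<phi> a)))"
    unfolding n_def prod_nth_eq_prod_count[OF permutations_of_multisetD[OF u]]
    by (simp add: sum_distrib_left exp_sum)
  moreover have "(\<Sum>v\<in>permutations_of_multiset A. \<Prod>i<n. g (u ! i) (v ! i))
      \<le> (exp 1 * (real n + 1)) ^ CARD('a) * real (card (permutations_of_multiset A)) * (\<Prod>i<n. \<phi> (u ! i))"
    unfolding n_def \<phi>_def q_def by (rule sum_type_class_prod_le) (rule g)
  ultimately show ?thesis by (simp add: \<phi>_def mult_ac)
qed

section \<open>Error probability of expurgated codes\<close>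

text \<open>The bracket in \<open>E_fun\<close>; at \<open>s = 1 / 2\<close> it is the Bhattacharyya
  coefficient.\<close>

definition chernoff :: "('x \<Rightarrow> 'y::finite pmf) \<Rightarrow> real \<Rightarrow> 'x \<Rightarrow> 'x \<Rightarrow> real" where
  "chernoff W s a b = (\<Sum>y\<in>UNIV. pmf (W a) y powr (1 - s) * pmf (W b) y powr s)"

lemma chernoff_nonneg: "chernoff W s a b \<ge> 0"
  unfolding chernoff_def by (intro sum_nonneg) auto

lemma chernoff_self: "chernoff W s a a = 1"
proof -
  have "chernoff W s a a = (\<Sum>y\<in>UNIV. pmf (W a) y)"
    by (simp add: chernoff_def flip: powr_add)
  also have "\<dots> = 1" by (rule sum_pmf_eq_1) auto
  finally show ?thesis .
qed

lemma block_prob_nonneg: "block_prob W n u v \<ge> 0"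
  unfolding block_prob_def by (intro prod_nonneg) auto

lemma sum_block_prob_powr:
  fixes W :: "'x \<Rightarrow> 'y::finite pmf"
  shows "(\<Sum>v\<in>blocks n. block_prob W n u v powr (1 - s) * block_prob W n u' v powr s)
    = (\<Prod>i<n. chernoff W s (u ! i) (u' ! i))"
  unfolding chernoff_def sum_blocks_prod[symmetric]
  by (simp add: block_prob_def prod_powr_distrib prod.distrib)

text \<open>Counting every tie as an error bounds all maximum likelihood decoders at once.\<close>

definition tie_error :: "('x \<Rightarrow> 'y pmf) \<Rightarrow> nat \<Rightarrow> nat \<Rightarrow> (nat \<Rightarrow> 'x list) \<Rightarrow> nat \<Rightarrow> real" where
  "tie_error W n M c m =
     (\<Sum>v\<in>{v \<in> blocks n. \<exists>m'\<in>{1..M} - {m}. block_prob W n (c m) v \<le> block_prob W n (c m') v}.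
        block_prob W n (c m) v)"

lemma error_prob_le_tie_error:
  fixes W :: "'x \<Rightarrow> 'y::finite pmf"
  assumes d: "max_likelihood_decoder W n M c d" and m: "m \<in> {1..M}"
  shows "error_prob W n c d m \<le> tie_error W n M c m"
  unfolding error_prob_def tie_error_def
proof (intro sum_mono2)
  \<comment> \<open>The competitor \<open>m'\<close> is the decoded message \<open>d v\<close>
    itself.\<close>
  show "{v \<in> blocks n. d v \<noteq> m}
    \<subseteq> {v \<in> blocks n. \<exists>m'\<in>{1..M} - {m}. block_prob W n (c m) v \<le> block_prob W n (c m') v}"
    using d m unfolding max_likelihood_decoder_def by blast
qed (auto simp: block_prob_nonneg)

text \<open>The right side is \<open>a\<close> times \<open>(b / a) powr s\<close>, which is at
  least 1; \<open>a = 0\<close> is separate because of the division.\<close>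

lemma le_powr_mult_powr:
  fixes a b s :: real
  assumes "0 \<le> a" "a \<le> b" "0 \<le> s"
  shows "a \<le> a powr (1 - s) * b powr s"
proof (cases "a = 0")
  case False
  then have "a = a powr (1 - s) * a powr s"
    using assms by (simp flip: powr_add)
  also have "\<dots> \<le> a powr (1 - s) * b powr s"
    using assms by (intro mult_left_mono powr_mono2) auto
  finally show ?thesis .
qed simp

text \<open>Union bound over the competitors, each bounded by the Chernoff weighting. Extending the
  sum to all output blocks makes it a product over positions.\<close>

lemma tie_error_le:
  fixes W :: "'x \<Rightarrow> 'y::finite pmf"
  assumes "0 \<le> s"
  shows "tie_error W n M c m \<le> (\<Sum>j\<in>{1..M} - {m}. \<Prod>i<n. chernoff W s (c m ! i) (c j ! i))"
proof -
  let ?t = "\<lambda>j v. block_prob W n (c m) v powr (1 - s) * block_prob W n (c j) v powr s"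
  let ?V = "{v \<in> blocks n. \<exists>m'\<in>{1..M} - {m}. block_prob W n (c m) v \<le> block_prob W n (c m') v}"
  have "tie_error W n M c m \<le> (\<Sum>v\<in>?V. \<Sum>j\<in>{1..M} - {m}. ?t j v)"
    unfolding tie_error_def
  proof (rule sum_mono)
    fix v assume "v \<in> ?V"
    then obtain j where j: "j \<in> {1..M} - {m}" "block_prob W n (c m) v \<le> block_prob W n (c j) v"
      by blast
    have "block_prob W n (c m) v \<le> ?t j v"
      by (rule le_powr_mult_powr[OF block_prob_nonneg j(2) assms])
    also have "\<dots> \<le> (\<Sum>j\<in>{1..M} - {m}. ?t j v)"
      using j(1) by (intro member_le_sum) auto
    finally show "block_prob W n (c m) v \<le> (\<Sum>j\<in>{1..M} - {m}. ?t j v)" .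
  qed
  also have "\<dots> \<le> (\<Sum>v\<in>blocks n. \<Sum>j\<in>{1..M} - {m}. ?t j v)"
    by (intro sum_mono2 sum_nonneg) auto
  also have "\<dots> = (\<Sum>j\<in>{1..M} - {m}. \<Prod>i<n. chernoff W s (c m ! i) (c j ! i))"
    by (subst sum.swap) (simp add: sum_block_prob_powr)
  finally show ?thesis .
qed

text \<open>Each \<open>b = a i powr (1 / \<rho>)\<close> is at most the sum \<open>S\<close> of all
  of them, so \<open>b powr \<rho> \<le> b * S powr (\<rho> - 1)\<close>; summing over
  \<open>i\<close> gives \<open>S powr \<rho>\<close>.\<close>

lemma sum_le_powr_sum_powr:
  fixes a :: "'i \<Rightarrow> real"
  assumes "finite I" "\<And>i. i \<in> I \<Longrightarrow> a i \<ge> 0" "\<rho> \<ge> 1"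
  shows "sum a I \<le> (\<Sum>i\<in>I. a i powr (1 / \<rho>)) powr \<rho>"
proof -
  define S where "S = (\<Sum>i\<in>I. a i powr (1 / \<rho>))"
  have split: "x powr \<rho> = x * x powr (\<rho> - 1)" if "x \<ge> 0" for x :: real
    using that by (cases "x = 0") (auto simp: powr_mult_base)
  have "S \<ge> 0" unfolding S_def by (intro sum_nonneg) auto
  have "sum a I \<le> (\<Sum>i\<in>I. a i powr (1 / \<rho>) * S powr (\<rho> - 1))"
  proof (rule sum_mono)
    fix i assume i: "i \<in> I"
    have "a i = (a i powr (1 / \<rho>)) powr \<rho>"
      using assms(2)[OF i] assms(3) by (simp add: powr_powr)
    also have "\<dots> = a i powr (1 / \<rho>) * (a i powr (1 / \<rho>)) powr (\<rho> - 1)"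
      by (rule split) auto
    also have "\<dots> \<le> a i powr (1 / \<rho>) * S powr (\<rho> - 1)"
    proof (intro mult_left_mono powr_mono2)
      show "a i powr (1 / \<rho>) \<le> S"
        unfolding S_def by (rule member_le_sum[OF i]) (use assms in auto)
    qed (use assms in auto)
    finally show "a i \<le> a i powr (1 / \<rho>) * S powr (\<rho> - 1)" .
  qed
  also have "\<dots> = S powr \<rho>"
    using split[OF \<open>S \<ge> 0\<close>] by (simp add: S_def sum_distrib_right)
  finally show ?thesis by (simp add: S_def)
qed

text \<open>Row sums are controlled for the roots \<open>D powr (1 / \<rho>)\<close>, and the power
  \<open>\<rho>\<close> is applied only afterwards, to the sum of a single message.\<close>

lemma exists_expurgated_code:
  fixes W :: "'x::finite \<Rightarrow> 'y::finite pmf" and A :: "'x multiset"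
  defines "n \<equiv> size A" and "q \<equiv> (\<lambda>a. real (count A a) / real (size A))"
  assumes "\<rho> \<ge> 1" "0 \<le> s"
  shows "\<exists>c\<in>{1..M} \<rightarrow>\<^sub>E permutations_of_multiset A. \<forall>m\<in>{1..M}. tie_error W n M c m
    \<le> (4 * real M * ((exp 1 * (real n + 1)) ^ CARD('x) *
         exp (real n * (\<Sum>a\<in>UNIV. q a * ln (\<Sum>b\<in>UNIV. q b * chernoff W s a b powr (1 / \<rho>)))))) powr \<rho>"
proof -
  define B where "B = (exp 1 * (real n + 1)) ^ CARD('x) *
    exp (real n * (\<Sum>a\<in>UNIV. q a * ln (\<Sum>b\<in>UNIV. q b * chernoff W s a b powr (1 / \<rho>))))"
  \<comment> \<open>The root is taken letter by letter, as the type class average requires; fact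
    \<open>f\<close> moves it outside the product for the power inequality.\<close>
  define f where "f u v = (\<Prod>i<n. chernoff W s (u ! i) (v ! i) powr (1 / \<rho>))" for u v
  have f0: "f u v \<ge> 0" for u v unfolding f_def by (intro prod_nonneg) auto
  have f: "f u v = (\<Prod>i<n. chernoff W s (u ! i) (v ! i)) powr (1 / \<rho>)" for u v
    unfolding f_def by (rule prod_powr_distrib[symmetric])
  have "\<exists>c\<in>{1..M} \<rightarrow>\<^sub>E permutations_of_multiset A.
      \<forall>m\<in>{1..M}. (\<Sum>j\<in>{1..M} - {m}. f (c m) (c j)) \<le> 4 * real M * B"
  proof (rule exists_small_row_sums)
    fix u assume "u \<in> permutations_of_multiset A"
    then show "(\<Sum>v\<in>permutations_of_multiset A. f u v) \<le> real (card (permutations_of_multiset A)) * B"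
      unfolding f_def B_def n_def q_def by (intro type_class_row_sum) (auto simp: chernoff_self)
  qed (auto simp: f0 B_def)
  then obtain c where c: "c \<in> {1..M} \<rightarrow>\<^sub>E permutations_of_multiset A"
    and sums: "\<And>m. m \<in> {1..M} \<Longrightarrow> (\<Sum>j\<in>{1..M} - {m}. f (c m) (c j)) \<le> 4 * real M * B"
    by blast
  have "tie_error W n M c m \<le> (4 * real M * B) powr \<rho>" if m: "m \<in> {1..M}" for m
  proof -
    have "tie_error W n M c m \<le> (\<Sum>j\<in>{1..M} - {m}. \<Prod>i<n. chernoff W s (c m ! i) (c j ! i))"
      by (rule tie_error_le) fact
    also have "\<dots> \<le> (\<Sum>j\<in>{1..M} - {m}. f (c m) (c j)) powr \<rho>"
      unfolding f by (rule sum_le_powr_sum_powr) (auto intro!: prod_nonneg chernoff_nonneg \<open>\<rho> \<ge> 1\<close>)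
    also have "\<dots> \<le> (4 * real M * B) powr \<rho>"
      using sums[OF m] \<open>\<rho> \<ge> 1\<close> by (intro powr_mono2 sum_nonneg f0) auto
    finally show ?thesis .
  qed
  with c show ?thesis unfolding B_def by blast
qed

section \<open>The sequence of codes\<close>

text \<open>Round \<open>n * pmf Q a\<close> down at all letters but one, \<open>z\<close>, which
  absorbs the remainder. Choosing \<open>z\<close> in the support of \<open>Q\<close> keeps all
  other letters of probability 0 absent.\<close>

lemma exists_types_tendsto:
  fixes Q :: "'a::finite pmf"
  shows "\<exists>A. \<forall>n. size (A n) = n \<and> (\<forall>a. pmf Q a = 0 \<longrightarrow> count (A n) a = 0) \<and>
    (\<forall>a. (\<lambda>n. real (count (A n) a) / real n) \<longlonglongrightarrow> pmf Q a)"
proof -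
  obtain z where z: "pmf Q z \<noteq> 0"
    using set_pmf_not_empty[of Q] by (auto simp: set_pmf_eq)
  define r where "r n a = nat \<lfloor>real n * pmf Q a\<rfloor>" for n a
  define k where "k n a = (if a = z then n - sum (r n) (UNIV - {z}) else r n a)" for n a
  define A where "A n = (\<Sum>a\<in>UNIV. replicate_mset (k n a) a)" for n
  have count: "count (A n) a = k n a" for n a
    by (simp add: A_def count_sum)
  have sumQ: "pmf Q z + sum (pmf Q) (UNIV - {z}) = 1"
    using sum_pmf_eq_1[of UNIV Q] by (simp add: sum.remove[of UNIV z])
  have r_le: "real (r n a) \<le> real n * pmf Q a" for n a
    by (simp add: r_def)
  have r_ge: "real n * pmf Q a - 1 \<le> real (r n a)" for n a
    unfolding r_def by linarith
  \<comment> \<open>This keeps the natural subtraction in \<open>k\<close> from truncating.\<close>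
  have le: "sum (r n) (UNIV - {z}) \<le> n" for n
  proof -
    have "real (sum (r n) (UNIV - {z})) \<le> (\<Sum>a\<in>UNIV - {z}. real n * pmf Q a)"
      unfolding of_nat_sum by (intro sum_mono r_le)
    also have "\<dots> = real n * sum (pmf Q) (UNIV - {z})" by (simp add: sum_distrib_left)
    also have "\<dots> \<le> real n * 1" using sumQ pmf_nonneg[of Q z] by (intro mult_left_mono) linarith+
    finally show ?thesis by (simp only: mult_1_right of_nat_le_iff)
  qed
  have "sum (k n) UNIV = n" for n
  proof -
    have "sum (k n) (UNIV - {z}) = sum (r n) (UNIV - {z})"
      by (intro sum.cong) (auto simp: k_def)
    then show ?thesis using le[of n] by (simp add: sum.remove[of UNIV z] k_def)
  qed
  then have size: "size (A n) = n" for n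
    by (simp add: size_multiset_eq_sum_UNIV count)
  have rlim: "(\<lambda>n. real (r n a) / real n) \<longlonglongrightarrow> pmf Q a" for a
  proof (rule tendsto_sandwich)
    show "\<forall>\<^sub>F n in sequentially. pmf Q a - 1 / real n \<le> real (r n a) / real n"
      using eventually_gt_at_top[of 0]
    proof eventually_elim
      case (elim n)
      then show ?case using divide_right_mono[OF r_ge[of n a], of "real n"] by (simp add: diff_divide_distrib)
    qed
    show "\<forall>\<^sub>F n in sequentially. real (r n a) / real n \<le> pmf Q a"
      using eventually_gt_at_top[of 0]
    proof eventually_elim
      case (elim n)
      then show ?case using r_le[of n a] by (simp add: field_simps)
    qed
    show "(\<lambda>n. pmf Q a - 1 / real n) \<longlonglongrightarrow> pmf Q a"
      using tendsto_diff[OF tendsto_const lim_1_over_n] by simp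
  qed simp
  have "(\<lambda>n. real (count (A n) a) / real n) \<longlonglongrightarrow> pmf Q a" for a
  proof (cases "a = z")
    case True
    have "(\<lambda>n. 1 - (\<Sum>b\<in>UNIV - {z}. real (r n b) / real n)) \<longlonglongrightarrow> 1 - sum (pmf Q) (UNIV - {z})"
      by (intro tendsto_intros rlim)
    also have "1 - sum (pmf Q) (UNIV - {z}) = pmf Q z" using sumQ by simp
    finally have lim: "(\<lambda>n. 1 - (\<Sum>b\<in>UNIV - {z}. real (r n b) / real n)) \<longlonglongrightarrow> pmf Q z" .
    have "\<forall>\<^sub>F n in sequentially. 1 - (\<Sum>b\<in>UNIV - {z}. real (r n b) / real n) = real (count (A n) z) / real n"
      using eventually_gt_at_top[of 0]
    proof eventually_elim
      case (elim n)
      then show ?case using le[of n]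
        by (simp add: count k_def of_nat_diff diff_divide_distrib sum_divide_distrib)
    qed
    then show ?thesis using Lim_transform_eventually[OF lim] True by simp
  next
    case False
    then show ?thesis using rlim[of a] by (simp add: count k_def)
  qed
  moreover have "count (A n) a = 0" if "pmf Q a = 0" for n a
    using that z by (auto simp: count k_def r_def)
  ultimately show ?thesis using size by blast
qed

text \<open>Outside the support of \<open>p\<close> the terms vanish for every \<open>n\<close>.
  Inside it, \<open>g a a = 1\<close> bounds the limiting argument of \<open>ln\<close> below by
  \<open>p a > 0\<close>, where \<open>ln\<close> is continuous.\<close>

lemma tendsto_sum_mult_ln:
  fixes q :: "nat \<Rightarrow> 'a::finite \<Rightarrow> real" and g :: "'a \<Rightarrow> 'a \<Rightarrow> real"
  assumes q: "\<And>a. (\<lambda>n. q n a) \<longlonglongrightarrow> p a" and zero: "\<And>n a. p a = 0 \<Longrightarrow> q n a = 0"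
    and p: "\<And>a. p a \<ge> 0" and g: "\<And>a b. g a b \<ge> 0" "\<And>a. g a a = 1"
  shows "(\<lambda>n. \<Sum>a\<in>UNIV. q n a * ln (\<Sum>b\<in>UNIV. q n b * g a b))
    \<longlonglongrightarrow> (\<Sum>a\<in>UNIV. p a * ln (\<Sum>b\<in>UNIV. p b * g a b))"
proof (rule tendsto_sum)
  fix a
  show "(\<lambda>n. q n a * ln (\<Sum>b\<in>UNIV. q n b * g a b)) \<longlonglongrightarrow> p a * ln (\<Sum>b\<in>UNIV. p b * g a b)"
  proof (cases "p a = 0")
    case True
    then show ?thesis by (simp add: zero)
  next
    case False
    have "p a * g a a \<le> (\<Sum>b\<in>UNIV. p b * g a b)"
      by (rule member_le_sum) (auto simp: p g)
    then have "(\<Sum>b\<in>UNIV. p b * g a b) \<noteq> 0" using False p[of a] by (simp add: g)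
    then show ?thesis by (intro tendsto_intros q)
  qed
qed

section \<open>From error bounds to the exponent\<close>

lemma neg_ln_ge:
  assumes "0 \<le> t" "t \<le> exp (- x)"
  shows "ereal x \<le> neg_ln t"
proof (cases "t = 0")
  case False
  then have "ln t \<le> ln (exp (- x))" using assms by (intro ln_mono) auto
  then show ?thesis using False by (simp add: neg_ln_def)
qed (simp add: neg_ln_def)

lemma codebook_size_pos: "codebook_size R n \<ge> 1"
  unfolding codebook_size_def by (simp add: Suc_le_eq)

text \<open>Rounding up adds at most 1, which is at most \<open>exp (n * R)\<close> for
  \<open>R \<ge> 0\<close>.\<close>

lemma codebook_size_le:
  assumes "R \<ge> 0"
  shows "real (codebook_size R n) \<le> 2 * exp (real n * R)"
proof -
  have "1 \<le> exp (real n * R)" using assms by simp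
  then show ?thesis unfolding codebook_size_def by linarith
qed

theorem theorem1:
  fixes W :: "'x::finite \<Rightarrow> 'y::finite pmf" and Q :: "'x pmf" and R :: real
  assumes "R \<ge> 0"
  shows "\<exists>C. code_seq R Q C \<and>
    (\<forall>d. (\<forall>n\<ge>1. max_likelihood_decoder W n (codebook_size R n) (C n) (d n)) \<longrightarrow>
       liminf (\<lambda>n. ereal (1 / real n) * neg_ln (max_error_prob W n (codebook_size R n) (C n) (d n)))
         \<ge> E_exponent W R Q)"
proof -
  obtain A where size: "\<And>n. size (A n) = n"
    and zero: "\<And>n a. pmf Q a = 0 \<Longrightarrow> count (A n) a = 0"
    and lim: "\<And>a. (\<lambda>n. real (count (A n) a) / real n) \<longlonglongrightarrow> pmf Q a"
    using exists_types_tendsto[of Q] by blast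
  let ?M = "codebook_size R"
  let ?codes = "\<lambda>n. {1..?M n} \<rightarrow>\<^sub>E permutations_of_multiset (A n)"
  \<comment> \<open>Measuring a code by \<open>tie_error\<close> lets it be chosen before the
    decoder is known.\<close>
  define worst where "worst n c = Max (tie_error W n (?M n) c ` {1..?M n})" for n c
  have M_ne: "{1..?M n} \<noteq> {}" for n using codebook_size_pos[of R n] by simp
  text \<open>The code may not depend on \<open>\<rho>\<close> and \<open>s\<close>, so the best one of the type class is taken.\<close>
  have "\<exists>c\<in>?codes n. \<forall>c'\<in>?codes n. worst n c \<le> worst n c'" for n
  proof -
    have "finite (?codes n)" by (intro finite_PiE) auto
    moreover have "?codes n \<noteq> {}" by (simp add: PiE_eq_empty_iff)
    ultimately have "Min (worst n ` ?codes n) \<in> worst n ` ?codes n" by (intro Min_in) auto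
    then obtain c where c: "c \<in> ?codes n" "Min (worst n ` ?codes n) = worst n c" by blast
    have "worst n c \<le> worst n c'" if "c' \<in> ?codes n" for c'
      unfolding c(2)[symmetric] using that \<open>finite (?codes n)\<close> by (intro Min_le) auto
    with c(1) show ?thesis by blast
  qed
  then obtain C where C: "\<And>n. C n \<in> ?codes n"
    and best: "\<And>n c'. c' \<in> ?codes n \<Longrightarrow> worst n (C n) \<le> worst n c'"
    by metis
  have mset_C: "mset (C n m) = A n" if "m \<in> {1..?M n}" for n m
    using C[of n] that by (auto simp: permutations_of_multiset_def)
  have "code_seq R Q C"
    unfolding code_seq_def
  proof (intro conjI exI allI impI ballI)
    fix n show "is_code n (?M n) (C n)"
      using mset_C[of _ n] size_mset[of "C n _"] size[of n]
      by (auto simp: is_code_def blocks_def simp flip: size_mset)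
  next
    fix n m assume "m \<in> {1..?M n}"
    then have "mset (C n m) = A n" by (rule mset_C)
    then have "count_list (C n m) a = count (A n) a" "length (C n m) = n" for a
      using size[of n] by (auto simp flip: count_mset size_mset)
    then show "empirical (C n m) = (\<lambda>a. real (count (A n) a) / real n)"
      by (auto simp: empirical_def)
  qed (rule lim)
  moreover have "E_exponent W R Q
      \<le> liminf (\<lambda>n. ereal (1 / real n) * neg_ln (max_error_prob W n (?M n) (C n) (d n)))"
    if d: "\<forall>n\<ge>1. max_likelihood_decoder W n (?M n) (C n) (d n)" for d
    unfolding E_exponent_def
  proof (intro SUP_least)
    fix \<rho> s :: real assume "\<rho> \<in> {1..}" "s \<in> {0..1}"
    then have \<rho>: "\<rho> \<ge> 1" and s: "0 \<le> s" by auto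
    define err where "err n = max_error_prob W n (?M n) (C n) (d n)" for n
    define L where "L n = (\<Sum>a\<in>UNIV. real (count (A n) a) / real n *
      ln (\<Sum>b\<in>UNIV. real (count (A n) b) / real n * chernoff W s a b powr (1 / \<rho>)))" for n
    define N where "N = real CARD('x)"
    \<comment> \<open>Minus the logarithm of the error bound: \<open>8 = 4 * 2\<close> combines the
      expurgation constant with the rounding of the codebook size, and the term with
      \<open>N\<close> is the polynomial factor.\<close>
    define X where "X n = \<rho> * (- ln 8 - N * (1 + ln (real n + 1)) - real n * R - real n * L n)" for n
    have err: "ereal (X n) \<le> neg_ln (err n)" if "n \<ge> 1" for n
    proof (rule neg_ln_ge)
      have dn: "max_likelihood_decoder W n (?M n) (C n) (d n)" using d that by blast
      have "1 \<in> {1..?M n}" using codebook_size_pos by simp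
      then have "error_prob W n (C n) (d n) 1 \<le> err n"
        unfolding err_def max_error_prob_def by (intro Max_ge) auto
      moreover have "0 \<le> error_prob W n (C n) (d n) 1"
        unfolding error_prob_def by (intro sum_nonneg block_prob_nonneg)
      ultimately show "0 \<le> err n" by linarith
      \<comment> \<open>This code depends on \<open>\<rho>\<close> and \<open>s\<close>; its bound
        passes to \<open>C n\<close> through \<open>best\<close>.\<close>
      obtain c where c: "c \<in> ?codes n"
        and tie: "\<And>m. m \<in> {1..?M n} \<Longrightarrow> tie_error W n (?M n) c m
          \<le> (4 * real (?M n) * ((exp 1 * (real n + 1)) ^ CARD('x) * exp (real n * L n))) powr \<rho>"
        using exists_expurgated_code[OF \<rho> s, where A = "A n" and M = "?M n" and W = W]
        unfolding size L_def by blast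
      have "err n \<le> worst n (C n)"
        unfolding err_def max_error_prob_def worst_def using M_ne[of n]
        by (intro Max.boundedI)
          (auto simp del: One_nat_def intro!: order_trans[OF error_prob_le_tie_error[OF dn] Max_ge])
      also have "\<dots> \<le> worst n c" by (rule best[OF c])
      also have "\<dots> \<le> (4 * real (?M n) * ((exp 1 * (real n + 1)) ^ CARD('x) * exp (real n * L n))) powr \<rho>"
        unfolding worst_def using M_ne[of n] tie by (intro Max.boundedI) auto
      also have "\<dots> \<le> (4 * (2 * exp (real n * R)) * ((exp 1 * (real n + 1)) ^ CARD('x) * exp (real n * L n))) powr \<rho>"
        using \<rho> codebook_size_le[OF assms, of n] by (intro powr_mono2 mult_right_mono mult_left_mono) auto
      also have "4 * (2 * exp (real n * R)) * ((exp 1 * (real n + 1)) ^ CARD('x) * exp (real n * L n))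
          = exp (ln 8 + real n * R + N * (1 + ln (real n + 1)) + real n * L n)"
        by (simp add: exp_add N_def exp_of_nat_mult mult_ac)
      also have "\<dots> powr \<rho> = exp (- X n)"
        by (simp add: powr_def X_def algebra_simps)
      finally show "err n \<le> exp (- X n)" .
    qed
    have "(\<lambda>n. \<rho> * (- ln 8 / real n - N * (1 / real n + ln (real n + 1) / real n) - R - L n))
        \<longlonglongrightarrow> \<rho> * (0 - N * (0 + 0) - R - (\<Sum>a\<in>UNIV. pmf Q a *
              ln (\<Sum>b\<in>UNIV. pmf Q b * chernoff W s a b powr (1 / \<rho>))))"
    proof (intro tendsto_mult tendsto_diff tendsto_add tendsto_const)
      show "(\<lambda>n. - ln 8 / real n) \<longlonglongrightarrow> 0" by real_asymp
      show "(\<lambda>n. 1 / real n) \<longlonglongrightarrow> 0" by real_asymp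
      show "(\<lambda>n. ln (real n + 1) / real n) \<longlonglongrightarrow> 0" by real_asymp
      show "L \<longlonglongrightarrow> (\<Sum>a\<in>UNIV. pmf Q a * ln (\<Sum>b\<in>UNIV. pmf Q b * chernoff W s a b powr (1 / \<rho>)))"
        unfolding L_def by (rule tendsto_sum_mult_ln) (auto simp: lim zero chernoff_self)
    qed
    also have "\<rho> * (0 - N * (0 + 0) - R - (\<Sum>a\<in>UNIV. pmf Q a *
        ln (\<Sum>b\<in>UNIV. pmf Q b * chernoff W s a b powr (1 / \<rho>)))) = E_fun W \<rho> s Q - \<rho> * R"
      by (simp add: E_fun_def chernoff_def algebra_simps)
    finally have "ereal (E_fun W \<rho> s Q - \<rho> * R)
        = liminf (\<lambda>n. ereal (\<rho> * (- ln 8 / real n - N * (1 / real n + ln (real n + 1) / real n) - R - L n)))"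
      by (intro lim_imp_Liminf[symmetric]) auto
    also have "\<dots> \<le> liminf (\<lambda>n. ereal (1 / real n) * neg_ln (err n))"
    proof (rule Liminf_mono)
      show "\<forall>\<^sub>F n in sequentially.
        ereal (\<rho> * (- ln 8 / real n - N * (1 / real n + ln (real n + 1) / real n) - R - L n))
          \<le> ereal (1 / real n) * neg_ln (err n)"
        \<comment> \<open>Both the decoder assumption and the division by \<open>real n\<close> call
          for \<open>n \<ge> 1\<close>.\<close>
        using eventually_ge_at_top[of 1]
      proof eventually_elim
        case (elim n)
        have "\<rho> * (- ln 8 / real n - N * (1 / real n + ln (real n + 1) / real n) - R - L n) = 1 / real n * X n"
          using elim by (simp add: X_def field_simps)
        moreover have "ereal (1 / real n) * ereal (X n) \<le> ereal (1 / real n) * neg_ln (err n)"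
          by (intro ereal_mult_left_mono err[OF elim]) simp
        ultimately show ?case by simp
      qed
    qed
    finally show "ereal (E_fun W \<rho> s Q - \<rho> * R)
      \<le> liminf (\<lambda>n. ereal (1 / real n) * neg_ln (max_error_prob W n (?M n) (C n) (d n)))"
      by (simp add: err_def)
  qed
  ultimately show ?thesis by blast
qed

end
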